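(* Let $R$ be a principal ideal domain and let $I=gR\subsetneq R$ be a proper, non-prime ideal such that $Q:=R/I$ is finite. Suppose that $g$ has exactly one prime factor up to association, i.e. $g=u\cdot p_1^{m_1}$ with $u$ a unit, $p_1$ a prime element and $m_1\ge 1$ an integer. Then the reduced zero divisor graph $\Gamma_E(Q)$ satisfies \[\dim_{TH}(\Gamma_E(Q))=\mathrm{box}(\Gamma_E(Q))=\begin{cases}0 & \text{if } m_1\le 3,\\ 1 & \text{if } m_1\ge 4.\end{cases}\]
   Context: Rings are commutative and non-zero with $1$. For a ring $Q$, $Z(Q)$ is the set of $r\in Q$ for which there is $s\in Q\setminus\{0\}$ with $rs=0$. The zero divisor graph $\Gamma(Q)$ has vertex set $Z(Q)\setminus\{0\}$; two distinct vertices $r,s$ are adjacent iff $rs=0$. For a graph $G=(V,E)$ write $u\sim v$ if $u$ and $v$ have the same set of neighbours; the reduced graph $G_E$ has as vertices the equivalence classes $[v]$ of $\sim$ and edges $\{[u],[v]\}$ for $\{u,v\}\in E$. $\Gamma_E(Q)$ is the reduced graph of $\Gamma(Q)$. The boxicity $\mathrm{box}(G)$ of a finite simple graph $G$ is the minimum integer $d\ge 0$ such that there exist $d$ interval graphs $I_1,\dots,I_d$ on $V(G)$ with $E(G)=\bigcap_{j=1}^d E(I_j)$. For a finite set $V$, $\alpha\colon V\to\mathbb{R}$ and $S\in\mathbb{R}$, the threshold graph $T(\alpha,S)$ has vertex set $V$ and edges all $\{v,w\}$, $v\neq w$, with $\alpha(v)+\alpha(w)\ge S$; a graph is a threshold graph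 if it is of this form. The threshold dimension $\dim_{TH}(G)$ is the minimum $d\ge 0$ such that there exist $d$ threshold graphs $H_1,\dots,H_d$ on $V(G)$ with $E(G)=\bigcap_{j=1}^d E(H_j)$. In both definitions the empty intersection ($d=0$) is the set of all pairs of vertices, so the parameter is $0$ exactly for complete graphs (including the graph with no vertices). *)

theory Defs
  imports Complex_Main "HOL-Algebra.Algebra"
begin

subsection \<open>Graphs\<close>

record 'a ugraph =
  verts :: "'a set"
  edges :: "'a set set"

definition vertex_pairs :: "'a set \<Rightarrow> 'a set set"
  where "vertex_pairs V = {{u, v} | u v. u \<in> V \<and> v \<in> V \<and> u \<noteq> v}"

definition simple_graph :: "'a ugraph \<Rightarrow> bool"
  where "simple_graph G \<longleftrightarrow> edges G \<subseteq> vertex_pairs (verts G)"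

definition neighbours :: "'a ugraph \<Rightarrow> 'a \<Rightarrow> 'a set"
  where "neighbours G v = {w \<in> verts G. {v, w} \<in> edges G}"

definition same_neighbours :: "'a ugraph \<Rightarrow> ('a \<times> 'a) set"
  where "same_neighbours G =
    {(u, v). u \<in> verts G \<and> v \<in> verts G \<and> neighbours G u = neighbours G v}"

definition reduced_graph :: "'a ugraph \<Rightarrow> 'a set ugraph"
  where "reduced_graph G =
    \<lparr> verts = verts G // same_neighbours G,
      edges = {{same_neighbours G `` {u}, same_neighbours G `` {v}} | u v.
        u \<in> verts G \<and> v \<in> verts G \<and> {u, v} \<in> edges G} \<rparr>"

subsection \<open>Boxicity and threshold dimension\<close>

text \<open>Interval graphs are the intersection graphs of finite families of nonempty compact
  intervals of the real line.\<close>

definition interval_graph :: "'a ugraph \<Rightarrow> bool"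
  where "interval_graph G \<longleftrightarrow> finite (verts G) \<and>
    (\<exists>l r :: 'a \<Rightarrow> real. (\<forall>v\<in>verts G. l v \<le> r v) \<and>
      edges G = {{u, v} | u v. u \<in> verts G \<and> v \<in> verts G \<and> u \<noteq> v \<and>
        {l u..r u} \<inter> {l v..r v} \<noteq> {}})"

definition threshold_graph_of :: "'a set \<Rightarrow> ('a \<Rightarrow> real) \<Rightarrow> real \<Rightarrow> 'a ugraph"
  where "threshold_graph_of V \<alpha> S =
    \<lparr> verts = V, edges = {{v, w} | v w. v \<in> V \<and> w \<in> V \<and> v \<noteq> w \<and> \<alpha> v + \<alpha> w \<ge> S} \<rparr>"

definition threshold_graph :: "'a ugraph \<Rightarrow> bool"
  where "threshold_graph G \<longleftrightarrow> finite (verts G) \<and> (\<exists>\<alpha> S. G = threshold_graph_of (verts G) \<alpha> S)"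

text \<open>Intersecting with \<^term>\<open>vertex_pairs (verts G)\<close> makes the empty intersection the
  edge set of the complete graph.\<close>

definition is_intersection_of ::
    "('a ugraph \<Rightarrow> bool) \<Rightarrow> 'a ugraph \<Rightarrow> nat \<Rightarrow> bool"
  where "is_intersection_of P G d \<longleftrightarrow>
    (\<exists>H :: nat \<Rightarrow> 'a ugraph. (\<forall>j<d. P (H j) \<and> verts (H j) = verts G) \<and>
      edges G = vertex_pairs (verts G) \<inter> (\<Inter>j\<in>{..<d}. edges (H j)))"

definition boxicity :: "'a ugraph \<Rightarrow> nat"
  where "boxicity G = (LEAST d. is_intersection_of interval_graph G d)"

definition threshold_dim :: "'a ugraph \<Rightarrow> nat"
  where "threshold_dim G = (LEAST d. is_intersection_of threshold_graph G d)"

text \<open>Both minima exist for finite simple graphs: every single pair of vertices can be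
  removed from the complete graph by an interval graph and by a threshold graph.\<close>

lemma is_intersection_of_exists:
  fixes G :: "'a ugraph"
  assumes fin: "finite (verts G)" and simple: "simple_graph G"
    and P: "\<And>u v. u \<in> verts G \<Longrightarrow> v \<in> verts G \<Longrightarrow> u \<noteq> v \<Longrightarrow>
      P \<lparr> verts = verts G, edges = vertex_pairs (verts G) - {{u, v}} \<rparr>"
  shows "\<exists>d. is_intersection_of P G d"
proof -
  define N where "N = vertex_pairs (verts G) - edges G"
  have "vertex_pairs (verts G) \<subseteq> Pow (verts G)"
    by (auto simp: vertex_pairs_def)
  then have "finite N"
    using fin by (auto simp: N_def intro: finite_subset)
  then obtain f :: "nat \<Rightarrow> 'a set" and d where f: "N = f ` {i. i < d}"
    using finite_imp_nat_seg_image_inj_on by metis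
  define H :: "nat \<Rightarrow> 'a ugraph" where
    "H j = \<lparr> verts = verts G, edges = vertex_pairs (verts G) - {f j} \<rparr>" for j
  have "P (H j)" if "j < d" for j
  proof -
    have "f j \<in> N" using f that by auto
    then obtain u v where "u \<in> verts G" "v \<in> verts G" "u \<noteq> v" "f j = {u, v}"
      by (auto simp: N_def vertex_pairs_def)
    then show ?thesis using P by (simp add: H_def)
  qed
  moreover have "edges G = vertex_pairs (verts G) \<inter> (\<Inter>j\<in>{..<d}. edges (H j))"
  proof -
    have "edges G = vertex_pairs (verts G) - N"
      using simple by (auto simp: N_def simple_graph_def)
    then show ?thesis unfolding f by (auto simp: H_def)
  qed
  ultimately show ?thesis
    unfolding is_intersection_of_def by (intro exI[of _ d] exI[of _ H]) (auto simp: H_def)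
qed

lemma vertex_pairs_minus_eq:
  assumes "\<And>a b. a \<noteq> b \<Longrightarrow> Q a b \<longleftrightarrow> {a, b} \<noteq> {u, v}"
  shows "vertex_pairs V - {{u, v}} = {{a, b} | a b. a \<in> V \<and> b \<in> V \<and> a \<noteq> b \<and> Q a b}"
proof (intro subset_antisym subsetI)
  fix e assume "e \<in> vertex_pairs V - {{u, v}}"
  then obtain a b where "e = {a, b}" "a \<in> V" "b \<in> V" "a \<noteq> b" "{a, b} \<noteq> {u, v}"
    unfolding vertex_pairs_def by blast
  moreover from this have "Q a b" using assms by simp
  ultimately show "e \<in> {{a, b} | a b. a \<in> V \<and> b \<in> V \<and> a \<noteq> b \<and> Q a b}"
    unfolding mem_Collect_eq by (intro exI[of _ a] exI[of _ b] conjI)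
next
  fix e assume "e \<in> {{a, b} | a b. a \<in> V \<and> b \<in> V \<and> a \<noteq> b \<and> Q a b}"
  then obtain a b where e: "e = {a, b}" "a \<in> V" "b \<in> V" "a \<noteq> b" and "Q a b"
    by blast
  then have "e \<noteq> {u, v}" using assms by simp
  with e show "e \<in> vertex_pairs V - {{u, v}}"
    unfolding vertex_pairs_def by blast
qed

lemma boxicity_attained:
  assumes "finite (verts G)" "simple_graph G"
  shows "is_intersection_of interval_graph G (boxicity G)"
proof -
  have "interval_graph \<lparr> verts = verts G, edges = vertex_pairs (verts G) - {{u, v}} \<rparr>"
    if "u \<noteq> v" for u v
  proof -
    let ?l = "\<lambda>w. if w = v then 1 else 0 :: real"
    let ?r = "\<lambda>w. if w = u then 0 else 1 :: real"
    have eq: "({?l a..?r a} \<inter> {?l b..?r b} \<noteq> {}) \<longleftrightarrow> {a, b} \<noteq> {u, v}" if "a \<noteq> b" for a b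
      using that \<open>u \<noteq> v\<close> by (auto simp: doubleton_eq_iff)
    have "vertex_pairs (verts G) - {{u, v}} = {{a, b} | a b. a \<in> verts G \<and> b \<in> verts G \<and>
        a \<noteq> b \<and> {?l a..?r a} \<inter> {?l b..?r b} \<noteq> {}}"
      by (rule vertex_pairs_minus_eq) (rule eq)
    moreover have "?l w \<le> ?r w" for w
      using \<open>u \<noteq> v\<close> by simp
    ultimately show ?thesis
      unfolding interval_graph_def ugraph.simps using assms(1)
      by (intro conjI exI[of _ ?l] exI[of _ ?r] ballI)
  qed
  then show ?thesis
    unfolding boxicity_def
    by (intro LeastI_ex[of "is_intersection_of interval_graph G"] is_intersection_of_exists[OF assms])
qed

lemma threshold_dim_attained:
  assumes "finite (verts G)" "simple_graph G"
  shows "is_intersection_of threshold_graph G (threshold_dim G)"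
proof -
  have "threshold_graph \<lparr> verts = verts G, edges = vertex_pairs (verts G) - {{u, v}} \<rparr>"
    if "u \<noteq> v" for u v
  proof -
    let ?a = "\<lambda>w. if w = u \<or> w = v then 0 else 1 :: real"
    have eq: "(?a a + ?a b \<ge> 1) \<longleftrightarrow> {a, b} \<noteq> {u, v}" if "a \<noteq> b" for a b
      using that \<open>u \<noteq> v\<close> by (auto simp: doubleton_eq_iff)
    have "vertex_pairs (verts G) - {{u, v}} = {{a, b} | a b. a \<in> verts G \<and> b \<in> verts G \<and>
        a \<noteq> b \<and> ?a a + ?a b \<ge> 1}"
      by (rule vertex_pairs_minus_eq) (rule eq)
    then show ?thesis
      unfolding threshold_graph_def threshold_graph_of_def ugraph.simps using assms(1)
      by (intro conjI exI[of _ ?a] exI[of _ "1::real"]) simp_all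
  qed
  then show ?thesis
    unfolding threshold_dim_def
    by (intro LeastI_ex[of "is_intersection_of threshold_graph G"] is_intersection_of_exists[OF assms])
qed

subsection \<open>Zero divisor graphs\<close>

text \<open>As in the literature on zero divisor graphs, \<open>\<zero>\<close> itself is a zero divisor.\<close>

definition zero_divisors :: "('a, 'b) ring_scheme \<Rightarrow> 'a set"
  where "zero_divisors Q =
    {r \<in> carrier Q. \<exists>s \<in> carrier Q - {\<zero>\<^bsub>Q\<^esub>}. r \<otimes>\<^bsub>Q\<^esub> s = \<zero>\<^bsub>Q\<^esub>}"

definition zero_divisor_graph :: "('a, 'b) ring_scheme \<Rightarrow> 'a ugraph"
  where "zero_divisor_graph Q =
    \<lparr> verts = zero_divisors Q - {\<zero>\<^bsub>Q\<^esub>},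
      edges = {{r, s} | r s. r \<in> zero_divisors Q - {\<zero>\<^bsub>Q\<^esub>} \<and> s \<in> zero_divisors Q - {\<zero>\<^bsub>Q\<^esub>} \<and>
        r \<noteq> s \<and> r \<otimes>\<^bsub>Q\<^esub> s = \<zero>\<^bsub>Q\<^esub>} \<rparr>"

abbreviation reduced_zero_divisor_graph :: "('a, 'b) ring_scheme \<Rightarrow> 'a set ugraph"
  where "reduced_zero_divisor_graph Q \<equiv> reduced_graph (zero_divisor_graph Q)"

lemma simple_zero_divisor_graph: "simple_graph (zero_divisor_graph Q)"
  unfolding simple_graph_def zero_divisor_graph_def vertex_pairs_def by auto

lemma simple_reduced_graph:
  assumes "simple_graph G"
  shows "simple_graph (reduced_graph G)"
proof -
  have "same_neighbours G `` {u} \<noteq> same_neighbours G `` {v}"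
    if uv: "u \<in> verts G" "v \<in> verts G" "{u, v} \<in> edges G" for u v
  proof
    assume "same_neighbours G `` {u} = same_neighbours G `` {v}"
    then have "neighbours G u = neighbours G v"
      using uv by (auto simp: same_neighbours_def)
    moreover have "v \<in> neighbours G u"
      using uv by (simp add: neighbours_def)
    ultimately have "{v} \<in> edges G"
      by (auto simp: neighbours_def)
    then show False
      using assms by (auto simp: simple_graph_def vertex_pairs_def doubleton_eq_iff)
  qed
  note ne = this
  show ?thesis
    unfolding simple_graph_def
  proof
    fix e assume "e \<in> edges (reduced_graph G)"
    then obtain u v where e: "e = {same_neighbours G `` {u}, same_neighbours G `` {v}}"
      and uv: "u \<in> verts G" "v \<in> verts G" "{u, v} \<in> edges G"
      unfolding reduced_graph_def ugraph.simps by blast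
    have "same_neighbours G `` {u} \<in> verts (reduced_graph G)"
      "same_neighbours G `` {v} \<in> verts (reduced_graph G)"
      using uv by (simp_all add: reduced_graph_def quotientI)
    with ne[OF uv] show "e \<in> vertex_pairs (verts (reduced_graph G))"
      unfolding vertex_pairs_def e by blast
  qed
qed

end

theory Submission
  imports Defs
begin

text \<open>Let \<open>v a\<close> be the \<open>p\<close>-adic valuation capped at \<open>m\<close>. In \<open>Q\<close> one has \<open>a b = 0\<close> iff
  \<open>v a + v b \<ge> m\<close>, so the zero divisor graph is a threshold graph. Threshold graphs pass to reduced
  graphs and are interval graphs, hence both parameters are at most \<open>1\<close>, and they vanish exactly if the
  reduced graph is complete. If \<open>m \<le> 3\<close>, two distinct non-adjacent vertices both have valuation \<open>1\<close>
  and thus the same neighbours. If \<open>m \<ge> 4\<close>, the classes of \<open>p\<close> and \<open>p^2\<close> are distinct and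
  non-adjacent.\<close>

subsection \<open>Threshold graphs, interval graphs and reduced graphs\<close>

text \<open>Both the interval and the threshold definition give edges in set-builder form; this
  trades it for a test on pairs of vertices. Symmetry of \<open>Q\<close> is what makes the test
  independent of the order in which an edge is listed.\<close>

lemma pair_set_eq_iff:
  assumes "\<And>u v. Q u v \<Longrightarrow> Q v u"
  shows "edges G = {{u, v} | u v. u \<in> verts G \<and> v \<in> verts G \<and> u \<noteq> v \<and> Q u v} \<longleftrightarrow>
    simple_graph G \<and> (\<forall>u\<in>verts G. \<forall>v\<in>verts G. u \<noteq> v \<longrightarrow> ({u, v} \<in> edges G \<longleftrightarrow> Q u v))"
    (is "_ = ?E \<longleftrightarrow> _")
proof -
  have E: "{u, v} \<in> ?E \<longleftrightarrow> Q u v" if "u \<in> verts G" "v \<in> verts G" "u \<noteq> v" for u v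
    using that assms by (auto simp: doubleton_eq_iff)
  show ?thesis
  proof (intro iffI conjI)
    assume eq: "edges G = ?E"
    show "simple_graph G"
      unfolding simple_graph_def eq vertex_pairs_def by blast
    show "\<forall>u\<in>verts G. \<forall>v\<in>verts G. u \<noteq> v \<longrightarrow> ({u, v} \<in> edges G \<longleftrightarrow> Q u v)"
      unfolding eq using E by blast
  next
    assume r: "simple_graph G \<and>
      (\<forall>u\<in>verts G. \<forall>v\<in>verts G. u \<noteq> v \<longrightarrow> ({u, v} \<in> edges G \<longleftrightarrow> Q u v))"
    show "edges G = ?E"
    proof (intro subset_antisym subsetI)
      fix e assume "e \<in> edges G"
      moreover from this r obtain u v where "e = {u, v}" "u \<in> verts G" "v \<in> verts G" "u \<noteq> v"
        unfolding simple_graph_def vertex_pairs_def by blast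
      ultimately show "e \<in> ?E" using r by blast
    next
      fix e assume "e \<in> ?E" then show "e \<in> edges G" using r by blast
    qed
  qed
qed

lemma threshold_graph_iff:
  fixes G :: "'a ugraph"
  shows "threshold_graph G \<longleftrightarrow> finite (verts G) \<and> simple_graph G \<and>
    (\<exists>(\<alpha> :: 'a \<Rightarrow> real) S. \<forall>u\<in>verts G. \<forall>v\<in>verts G. u \<noteq> v \<longrightarrow> ({u, v} \<in> edges G \<longleftrightarrow> S \<le> \<alpha> u + \<alpha> v))"
proof -
  have "G = threshold_graph_of (verts G) \<alpha> S \<longleftrightarrow>
      edges G = {{u, v} | u v. u \<in> verts G \<and> v \<in> verts G \<and> u \<noteq> v \<and> S \<le> \<alpha> u + \<alpha> v}" for \<alpha> :: "'a \<Rightarrow> real" and S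
    unfolding threshold_graph_of_def by (cases G) simp
  also have "\<dots> \<alpha> S \<longleftrightarrow> simple_graph G \<and>
      (\<forall>u\<in>verts G. \<forall>v\<in>verts G. u \<noteq> v \<longrightarrow> ({u, v} \<in> edges G \<longleftrightarrow> S \<le> \<alpha> u + \<alpha> v))" for \<alpha> :: "'a \<Rightarrow> real" and S
    by (rule pair_set_eq_iff) (simp add: add.commute)
  finally show ?thesis
    unfolding threshold_graph_def by simp
qed

lemma interval_graph_iff:
  fixes G :: "'a ugraph"
  shows "interval_graph G \<longleftrightarrow> finite (verts G) \<and> simple_graph G \<and>
    (\<exists>l r :: 'a \<Rightarrow> real. (\<forall>v\<in>verts G. l v \<le> r v) \<and>
      (\<forall>u\<in>verts G. \<forall>v\<in>verts G. u \<noteq> v \<longrightarrow> ({u, v} \<in> edges G \<longleftrightarrow> {l u..r u} \<inter> {l v..r v} \<noteq> {})))"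
proof -
  have "edges G = {{u, v} | u v. u \<in> verts G \<and> v \<in> verts G \<and> u \<noteq> v \<and>
        {l u..r u} \<inter> {l v..r v} \<noteq> {}} \<longleftrightarrow> simple_graph G \<and>
      (\<forall>u\<in>verts G. \<forall>v\<in>verts G. u \<noteq> v \<longrightarrow> ({u, v} \<in> edges G \<longleftrightarrow> {l u..r u} \<inter> {l v..r v} \<noteq> {}))"
    for l r :: "'a \<Rightarrow> real"
    by (rule pair_set_eq_iff) blast
  note eq = this
  show ?thesis
    unfolding interval_graph_def eq by blast
qed

lemma finite_pos_lower_bound:
  fixes D :: "real set"
  assumes "finite D"
  shows "\<exists>\<delta>>0. \<forall>x\<in>D. 0 < x \<longrightarrow> \<delta> \<le> x"
proof -
  \<comment> \<open>Inserting 1 keeps the set non-empty, so that the minimum exists even if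
    \<open>D\<close> has no positive element.\<close>
  let ?D = "insert 1 {x \<in> D. 0 < x}"
  have fin: "finite ?D" using assms by simp
  have "Min ?D \<in> ?D" using fin by (intro Min_in) simp_all
  then have "0 < Min ?D" by (rule insertE) (simp_all only: mem_Collect_eq zero_less_one)
  moreover have "\<forall>x\<in>D. 0 < x \<longrightarrow> Min ?D \<le> x"
    using Min_le[OF fin] by blast
  ultimately show ?thesis by blast
qed

text \<open>Vertices of weight at least \<open>S/2\<close> form a clique and get intervals with a common left end
  and right end \<open>\<alpha> v\<close>; the other vertices are independent and become the points \<open>S - \<alpha> v\<close>,
  perturbed by less than the least gap \<open>\<delta>\<close> so that they are pairwise distinct.\<close>

lemma threshold_graph_imp_interval_graph:
  fixes G :: "'a ugraph"
  assumes "threshold_graph G"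
  shows "interval_graph G"
proof -
  let ?V = "verts G"
  obtain \<alpha> :: "'a \<Rightarrow> real" and S where fin: "finite ?V" and sim: "simple_graph G"
    and adj: "\<And>u v. u \<in> ?V \<Longrightarrow> v \<in> ?V \<Longrightarrow> u \<noteq> v \<Longrightarrow> {u, v} \<in> edges G \<longleftrightarrow> S \<le> \<alpha> u + \<alpha> v"
    using assms unfolding threshold_graph_iff by blast
  obtain f :: "'a \<Rightarrow> nat" and n where "f ` ?V = {i. i < n}" and inj: "inj_on f ?V"
    using finite_imp_inj_to_nat_seg[OF fin] by blast
  then have f: "f v < n" if "v \<in> ?V" for v
    using that by blast
  \<comment> \<open>Positive values of the first kind are the deficits of pairs with weight sum
    below \<open>S\<close>, those of the second kind the distances between different weights;
    \<delta> bounds both from below.\<close>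
  define D where "D = (\<lambda>(u, v). S - \<alpha> u - \<alpha> v) ` (?V \<times> ?V) \<union> (\<lambda>(u, v). \<alpha> u - \<alpha> v) ` (?V \<times> ?V)"
  have "finite D" unfolding D_def using fin by simp
  then obtain \<delta> where \<delta>: "0 < \<delta>" and \<delta>D: "\<And>x. x \<in> D \<Longrightarrow> 0 < x \<Longrightarrow> \<delta> \<le> x"
    using finite_pos_lower_bound by blast
  have gap: "\<delta> \<le> S - \<alpha> u - \<alpha> v" if "u \<in> ?V" "v \<in> ?V" "\<alpha> u + \<alpha> v < S" for u v
    using that by (intro \<delta>D) (auto simp: D_def image_iff)
  have gap': "\<delta> \<le> \<alpha> u - \<alpha> v" if "u \<in> ?V" "v \<in> ?V" "\<alpha> v < \<alpha> u" for u v
    using that by (intro \<delta>D) (auto simp: D_def image_iff)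
  \<comment> \<open>The perturbation: numbering the vertices by \<open>f\<close> gives distinct
    values in the half-open interval from 0 to \<delta>.\<close>
  define e where "e v = \<delta> * (real (f v) / real n)" for v
  have e0: "0 \<le> e v" for v
    unfolding e_def using \<delta> by simp
  have e1: "e v < \<delta>" if "v \<in> ?V" for v
    unfolding e_def using \<delta> f[OF that] by (simp add: field_simps)
  have e_inj: "e u \<noteq> e v" if "u \<in> ?V" "v \<in> ?V" "u \<noteq> v" for u v
    unfolding e_def using \<delta> f[OF that(1)] inj_onD[OF inj _ that(1,2)] that(3)
    by (auto simp: field_simps)
  define c where "c v = S - \<alpha> v - e v" for v
  \<comment> \<open>A light vertex has S - \<alpha> v > S/2 and is shifted left by less than
    \<delta>, so \<open>S / 2 - \<delta>\<close> lies to the left of every point and only the right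
    ends of the clique intervals matter.\<close>
  define l where "l v = (if S \<le> 2 * \<alpha> v then S / 2 - \<delta> else c v)" for v
  define r where "r v = (if S \<le> 2 * \<alpha> v then \<alpha> v else c v)" for v
  \<comment> \<open>A left shift by less than \<delta> cannot bridge a deficit of at least \<delta>,
    so no new intersection arises.\<close>
  have c_le: "c v \<le> \<alpha> u \<longleftrightarrow> S \<le> \<alpha> v + \<alpha> u" if "u \<in> ?V" "v \<in> ?V" for u v
    using gap[of v u] e0[of v] e1[of v] that unfolding c_def by linarith
  have c_ge: "S / 2 - \<delta> \<le> c v" if "v \<in> ?V" "2 * \<alpha> v < S" for v
    using e1[OF that(1)] that(2) unfolding c_def by linarith
  \<comment> \<open>Different weights are at least \<delta> apart, more than two perturbations can
    differ; equal weights are separated by \<open>e\<close>.\<close>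
  have c_inj: "c u \<noteq> c v" if "u \<in> ?V" "v \<in> ?V" "u \<noteq> v" for u v
    using gap'[of u v] gap'[of v u] e0[of u] e0[of v] e1[of u] e1[of v] e_inj[OF that] that
    unfolding c_def by linarith
  have "l v \<le> r v" for v
    unfolding l_def r_def using \<delta> by simp
  moreover have "{u, v} \<in> edges G \<longleftrightarrow> {l u..r u} \<inter> {l v..r v} \<noteq> {}"
    if uv: "u \<in> ?V" "v \<in> ?V" "u \<noteq> v" for u v
  proof -
    have "S \<le> \<alpha> u + \<alpha> v \<longleftrightarrow> max (l u) (l v) \<le> min (r u) (r v)"
      using \<delta> c_le[of u v] c_le[of v u] c_ge[of u] c_ge[of v] c_inj[OF uv] uv
      unfolding l_def r_def by auto
    then show ?thesis
      by (auto simp: adj[OF uv])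
  qed
  ultimately show ?thesis
    unfolding interval_graph_iff using fin sim by blast
qed

section \<open>Passage to the reduced graph\<close>

lemma edge_reduced_graph_iff:
  assumes "simple_graph G" "u \<in> verts G" "v \<in> verts G"
  shows "{same_neighbours G `` {u}, same_neighbours G `` {v}} \<in> edges (reduced_graph G) \<longleftrightarrow>
    {u, v} \<in> edges G"
proof
  let ?c = "\<lambda>x. same_neighbours G `` {x}"
  have N: "y \<in> neighbours G x \<longleftrightarrow> {x, y} \<in> edges G" if "y \<in> verts G" for x y
    using that by (simp add: neighbours_def)
  \<comment> \<open>An edge survives replacing its ends, one at a time, by vertices with the same
    neighbours.\<close>
  have transfer: "{u, v} \<in> edges G"
    if "?c u = ?c a" "?c v = ?c b" "a \<in> verts G" "b \<in> verts G" "{a, b} \<in> edges G" for a b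
  proof -
    have "neighbours G u = neighbours G a" "neighbours G v = neighbours G b"
      using that assms by (auto simp: same_neighbours_def)
    then show ?thesis
      using N[of b a] N[of u b] N[of b u] N[of u v] that assms by (simp add: insert_commute)
  qed
  assume "{?c u, ?c v} \<in> edges (reduced_graph G)"
  then obtain a b where "{?c u, ?c v} = {?c a, ?c b}" "a \<in> verts G" "b \<in> verts G" "{a, b} \<in> edges G"
    unfolding reduced_graph_def ugraph.simps by blast
  then show "{u, v} \<in> edges G"
    using transfer[of a b] transfer[of b a] by (auto simp: doubleton_eq_iff insert_commute)
next
  assume "{u, v} \<in> edges G"
  then show "{same_neighbours G `` {u}, same_neighbours G `` {v}} \<in> edges (reduced_graph G)"
    unfolding reduced_graph_def ugraph.simps using assms by blast
qed

lemma equiv_same_neighbours: "equiv (verts G) (same_neighbours G)"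
  by (rule equivI) (auto simp: same_neighbours_def refl_on_def sym_def trans_def)

lemma same_neighbours_class_eq_iff:
  assumes "u \<in> verts G" "v \<in> verts G"
  shows "same_neighbours G `` {u} = same_neighbours G `` {v} \<longleftrightarrow> neighbours G u = neighbours G v"
  using eq_equiv_class_iff[OF equiv_same_neighbours assms] assms by (simp add: same_neighbours_def)

text \<open>One representative per class identifies the reduced graph with an induced subgraph of
  \<open>G\<close>, to which the weights restrict.\<close>

lemma threshold_graph_reduced_graph:
  fixes G :: "'a ugraph"
  assumes "threshold_graph G"
  shows "threshold_graph (reduced_graph G)"
proof -
  obtain \<alpha> :: "'a \<Rightarrow> real" and S where fin: "finite (verts G)" and sim: "simple_graph G"
    and adj: "\<And>u v. u \<in> verts G \<Longrightarrow> v \<in> verts G \<Longrightarrow> u \<noteq> v \<Longrightarrow> {u, v} \<in> edges G \<longleftrightarrow> S \<le> \<alpha> u + \<alpha> v"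
    using assms unfolding threshold_graph_iff by blast
  define rep where "rep C = (SOME v. v \<in> verts G \<and> C = same_neighbours G `` {v})" for C
  have rep: "rep C \<in> verts G" "C = same_neighbours G `` {rep C}" if "C \<in> verts (reduced_graph G)" for C
  proof -
    have "\<exists>v. v \<in> verts G \<and> C = same_neighbours G `` {v}"
      using that by (auto simp: reduced_graph_def elim: quotientE)
    then have "rep C \<in> verts G \<and> C = same_neighbours G `` {rep C}"
      unfolding rep_def by (rule someI_ex)
    then show "rep C \<in> verts G" "C = same_neighbours G `` {rep C}"
      by blast+
  qed
  have "{C, D} \<in> edges (reduced_graph G) \<longleftrightarrow> S \<le> \<alpha> (rep C) + \<alpha> (rep D)"
    if "C \<in> verts (reduced_graph G)" "D \<in> verts (reduced_graph G)" "C \<noteq> D" for C D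
    using edge_reduced_graph_iff[OF sim, of "rep C" "rep D"] adj[of "rep C" "rep D"]
      rep[OF that(1)] rep[OF that(2)] that(3) by metis
  moreover have "finite (verts (reduced_graph G))"
    using fin by (simp add: reduced_graph_def quotient_def)
  ultimately show ?thesis
    unfolding threshold_graph_iff using simple_reduced_graph[OF sim]
    by (intro conjI exI[of _ "\<lambda>C. \<alpha> (rep C)"] exI[of _ S]) simp_all
qed

lemma vertex_pairs_image:
  "vertex_pairs (f ` V) = {{f u, f v} | u v. u \<in> V \<and> v \<in> V \<and> f u \<noteq> f v}"
    (is "_ = ?P")
proof (intro subset_antisym subsetI)
  fix e assume "e \<in> vertex_pairs (f ` V)"
  then obtain x y where e: "e = {x, y}" "x \<in> f ` V" "y \<in> f ` V" "x \<noteq> y"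
    unfolding vertex_pairs_def by blast
  then obtain u v where "u \<in> V" "x = f u" "v \<in> V" "y = f v" by blast
  with e show "e \<in> ?P" by blast
qed (auto simp: vertex_pairs_def)

text \<open>Brings completeness of the reduced graph, which decides between the values 0 and 1, back
  to a condition on \<open>G\<close> itself.\<close>

lemma complete_reduced_graph_iff:
  fixes G :: "'a ugraph"
  assumes "simple_graph G"
  shows "edges (reduced_graph G) = vertex_pairs (verts (reduced_graph G)) \<longleftrightarrow>
    (\<forall>u\<in>verts G. \<forall>v\<in>verts G. neighbours G u \<noteq> neighbours G v \<longrightarrow> {u, v} \<in> edges G)"
proof -
  let ?c = "\<lambda>x. same_neighbours G `` {x}"
  have pairs: "vertex_pairs (verts (reduced_graph G)) =
      {{?c u, ?c v} | u v. u \<in> verts G \<and> v \<in> verts G \<and> neighbours G u \<noteq> neighbours G v}" (is "_ = ?P")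
  proof -
    have "verts (reduced_graph G) = ?c ` verts G"
      by (auto simp: reduced_graph_def quotient_def)
    then show ?thesis
      by (simp add: vertex_pairs_image same_neighbours_class_eq_iff cong: conj_cong)
  qed
  have "edges (reduced_graph G) \<subseteq> ?P"
    using simple_reduced_graph[OF assms] unfolding simple_graph_def pairs .
  then have "edges (reduced_graph G) = ?P \<longleftrightarrow> ?P \<subseteq> edges (reduced_graph G)"
    by (simp only: set_eq_subset simp_thms)
  also have "\<dots> \<longleftrightarrow> (\<forall>u\<in>verts G. \<forall>v\<in>verts G. neighbours G u \<noteq> neighbours G v \<longrightarrow>
      {?c u, ?c v} \<in> edges (reduced_graph G))" (is "_ \<longleftrightarrow> ?R")
  proof
    assume sub: "?P \<subseteq> edges (reduced_graph G)"
    show ?R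
      by (intro ballI impI subsetD[OF sub]) blast
  next
    assume ?R
    then show "?P \<subseteq> edges (reduced_graph G)"
      by clarify simp
  qed
  also have "\<dots> \<longleftrightarrow> (\<forall>u\<in>verts G. \<forall>v\<in>verts G. neighbours G u \<noteq> neighbours G v \<longrightarrow> {u, v} \<in> edges G)"
    using edge_reduced_graph_iff[OF assms] by simp
  finally show ?thesis
    unfolding pairs .
qed

text \<open>The graph is the intersection of the one-member family consisting of itself, and the
  empty family yields only the complete graph. Keeping \<open>P\<close> abstract serves boxicity and
  threshold dimension at once.\<close>

lemma least_is_intersection_of:
  assumes "P G" "simple_graph G"
  shows "(LEAST d. is_intersection_of P G d) = (if edges G = vertex_pairs (verts G) then 0 else 1)"
proof -
  have zero: "is_intersection_of P G 0 \<longleftrightarrow> edges G = vertex_pairs (verts G)"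
    unfolding is_intersection_of_def by simp
  have one: "is_intersection_of P G 1"
    unfolding is_intersection_of_def using assms
    by (intro exI[of _ "\<lambda>_. G"]) (auto simp: simple_graph_def)
  show ?thesis
  proof (cases "edges G = vertex_pairs (verts G)")
    case True
    then show ?thesis
      using zero by (simp add: Least_equality)
  next
    case False
    then have "(LEAST d. is_intersection_of P G d) = 1"
      using one zero by (intro Least_equality) (auto simp: Suc_le_eq intro!: Nat.gr0I)
    with False show ?thesis by simp
  qed
qed

lemma threshold_graph_dimensions:
  assumes "threshold_graph G"
  shows "threshold_dim G = (if edges G = vertex_pairs (verts G) then 0 else 1)"
    and "boxicity G = (if edges G = vertex_pairs (verts G) then 0 else 1)"
proof -
  have sim: "simple_graph G"
    using assms by (simp add: threshold_graph_iff)
  show "threshold_dim G = (if edges G = vertex_pairs (verts G) then 0 else 1)"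
    unfolding threshold_dim_def using assms sim by (rule least_is_intersection_of)
  show "boxicity G = (if edges G = vertex_pairs (verts G) then 0 else 1)"
    unfolding boxicity_def using threshold_graph_imp_interval_graph[OF assms] sim
    by (rule least_is_intersection_of)
qed

subsection \<open>Prime powers\<close>

text \<open>The cap \<open>k \<le> m\<close> keeps the set finite even for \<open>\<zero>\<close>,
  which all powers of a ring element \<open>p\<close> divide and which therefore gets the value
  \<open>m\<close>.\<close>

definition truncated_val :: "('a, 'b) ring_scheme \<Rightarrow> 'a \<Rightarrow> nat \<Rightarrow> 'a \<Rightarrow> nat"
  where "truncated_val R p m a = Max {k. k \<le> m \<and> p [^]\<^bsub>R\<^esub> k divides\<^bsub>R\<^esub> a}"

lemma (in ring) truncated_val:
  assumes "a \<in> carrier R"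
  shows "truncated_val R p m a \<le> m" and "p [^] truncated_val R p m a divides a"
    and "k \<le> m \<Longrightarrow> p [^] k divides a \<Longrightarrow> k \<le> truncated_val R p m a"
proof -
  let ?K = "{k. k \<le> m \<and> p [^] k divides a}"
  have fin: "finite ?K" by simp
  have "0 \<in> ?K" using assms by (simp add: one_divides)
  then have "Max ?K \<in> ?K" using fin by (intro Max_in) auto
  then show "truncated_val R p m a \<le> m" "p [^] truncated_val R p m a divides a"
    by (simp_all add: truncated_val_def)
  show "k \<le> truncated_val R p m a" if "k \<le> m" "p [^] k divides a"
    unfolding truncated_val_def using that by (intro Max_ge[OF fin]) simp
qed

lemma (in domain) nat_pow_nonzero:
  assumes "p \<in> carrier R" "p \<noteq> \<zero>"
  shows "p [^] (k::nat) \<noteq> \<zero>"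
  using assms by (induction k) (auto simp: integral_iff)

text \<open>Cancellation of the nonzero factor \<open>p [^] k\<close>.\<close>

lemma (in domain) pow_divides_mult_pow_iff:
  assumes "p \<in> carrier R" "p \<noteq> \<zero>" "c \<in> carrier R" "k < m"
  shows "p [^] (m::nat) divides p [^] (k::nat) \<otimes> c \<longleftrightarrow> p [^] (m - k) divides c"
proof -
  have pk: "p [^] k \<in> carrier R - {\<zero>}"
    using assms by (simp add: nat_pow_nonzero)
  have "p [^] m = p [^] k \<otimes> p [^] (m - k)"
    using assms by (simp add: nat_pow_mult)
  then show ?thesis
    using mult_divides[OF _ assms(3) pk, of "p [^] (m - k)"]
      divides_mult[of "p [^] (m - k)" "p [^] k" c] pk assms by auto
qed

text \<open>After cancelling \<open>p [^] k\<close>, the remaining power has exponent at least 1 and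
  would force \<open>p\<close> to divide \<open>c\<close>.\<close>

lemma (in domain) not_pow_divides:
  assumes "p \<in> carrier R" "ring_prime p" "c \<in> carrier R" "\<not> p divides c" "k < m"
  shows "\<not> p [^] (m::nat) divides p [^] (k::nat) \<otimes> c"
proof
  assume "p [^] m divides p [^] k \<otimes> c"
  then have "p [^] (m - k) divides c"
    using pow_divides_mult_pow_iff ring_primeE(1) assms by blast
  moreover have "p divides p [^] (m - k)"
  proof -
    have "p [^] (m - k) = p \<otimes> p [^] (m - k - 1)"
      using assms by (cases "m - k") (auto simp: m_comm)
    then show ?thesis using assms by blast
  qed
  ultimately show False
    using assms divides_trans by blast
qed

text \<open>Valuations add: with the maximal powers of \<open>p\<close> split off, primality keeps
  \<open>p\<close> from dividing the product of the cofactors.\<close>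

lemma (in domain) pow_divides_mult_iff:
  assumes p: "p \<in> carrier R" "ring_prime p" and ab: "a \<in> carrier R" "b \<in> carrier R"
  shows "p [^] m divides a \<otimes> b \<longleftrightarrow> m \<le> truncated_val R p m a + truncated_val R p m b"
proof -
  let ?i = "truncated_val R p m a" and ?j = "truncated_val R p m b"
  obtain a' where a': "a' \<in> carrier R" "a = p [^] ?i \<otimes> a'"
    using truncated_val(2)[OF ab(1)] by blast
  obtain b' where b': "b' \<in> carrier R" "b = p [^] ?j \<otimes> b'"
    using truncated_val(2)[OF ab(2)] by blast
  have prod: "a \<otimes> b = p [^] (?i + ?j) \<otimes> (a' \<otimes> b')"
  proof -
    have "a \<otimes> b = (p [^] ?i \<otimes> a') \<otimes> (p [^] ?j \<otimes> b')"
      using a' b' by simp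
    also have "\<dots> = p [^] (?i + ?j) \<otimes> (a' \<otimes> b')"
      using p(1) a'(1) b'(1) by (simp add: nat_pow_mult[symmetric] m_ac)
    finally show ?thesis .
  qed
  \<comment> \<open>Another factor \<open>p\<close> in the cofactor would contradict maximality of
    the valuation, provided that the cap is not reached.\<close>
  have ndvd: "\<not> p divides x'"
    if "x \<in> carrier R" "x' \<in> carrier R" "x = p [^] truncated_val R p m x \<otimes> x'"
      "truncated_val R p m x < m" for x x'
  proof
    assume "p divides x'"
    then have "p [^] truncated_val R p m x \<otimes> p divides p [^] truncated_val R p m x \<otimes> x'"
      using p by (intro divides_mult) auto
    then have "p [^] Suc (truncated_val R p m x) divides x"
      using that(3) by simp
    then show False
      using truncated_val(3)[OF that(1), of "Suc (truncated_val R p m x)" m p] that(4) by simp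
  qed
  show ?thesis
  proof (cases "m \<le> ?i + ?j")
    case True
    then have "p [^] (?i + ?j) = p [^] m \<otimes> p [^] (?i + ?j - m)"
      using p by (simp add: nat_pow_mult)
    then have "p [^] m divides p [^] (?i + ?j)"
      using p by blast
    then show ?thesis
      using True p a' b' by (simp add: prod divides_prod_r)
  next
    case False
    \<comment> \<open>A sum below \<open>m\<close> forces both valuations below the cap.\<close>
    then have "\<not> p divides a'" "\<not> p divides b'"
      using ndvd[OF ab(1) a'] ndvd[OF ab(2) b'] by auto
    then have "\<not> p divides a' \<otimes> b'"
      using ring_primeE(3)[OF p] a' b' by (auto simp: prime_def)
    then have "\<not> p [^] m divides a \<otimes> b"
      unfolding prod using False p a' b' by (intro not_pow_divides) auto
    with False show ?thesis by simp
  qed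
qed

section \<open>Arithmetic modulo a principal ideal\<close>

lemma (in cring) mem_PIdl_iff:
  assumes "g \<in> carrier R" "a \<in> carrier R"
  shows "a \<in> PIdl g \<longleftrightarrow> g divides a"
  using assms by (auto simp: cgenideal_def factor_def m_comm)

lemma (in ring) carrier_FactRing: "carrier (R Quot I) = (+>) I ` carrier R"
  by (auto simp: FactRing_def A_RCOSETS_def')

lemma (in cring) coset_PIdl_eq_iff:
  assumes "g \<in> carrier R" "a \<in> carrier R" "b \<in> carrier R"
  shows "PIdl g +> a = PIdl g +> b \<longleftrightarrow> g divides (a \<ominus> b)"
  using quotient_eq_iff_same_a_r_cos[OF cgenideal_ideal[OF assms(1)] assms(2,3)]
    mem_PIdl_iff[of g "a \<ominus> b"] assms by simp

lemma (in cring) coset_PIdl_eq_zero_iff: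
  assumes "g \<in> carrier R" "a \<in> carrier R"
  shows "PIdl g +> a = \<zero>\<^bsub>R Quot PIdl g\<^esub> \<longleftrightarrow> g divides a"
proof -
  have "PIdl g +> \<zero> = PIdl g"
    using a_rcos_zero[OF cgenideal_ideal[OF assms(1)]] additive_subgroup.zero_closed
      ideal.axioms(1)[OF cgenideal_ideal[OF assms(1)]] by blast
  moreover have "a \<ominus> \<zero> = a"
    using assms by (simp add: a_minus_def)
  ultimately show ?thesis
    using coset_PIdl_eq_iff[OF assms zero_closed] by (simp add: FactRing_def)
qed

lemma (in cring) coset_PIdl_mult:
  assumes "g \<in> carrier R" "a \<in> carrier R" "b \<in> carrier R"
  shows "(PIdl g +> a) \<otimes>\<^bsub>R Quot PIdl g\<^esub> (PIdl g +> b) = PIdl g +> (a \<otimes> b)"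
  using ideal.rcoset_mult_add[OF cgenideal_ideal[OF assms(1)] assms(2,3)]
  by (simp add: FactRing_def)

text \<open>The valuation of a coset is that of a chosen representative. Any choice works, since
  vanishing of a coset or of a product of cosets can be tested on representatives.\<close>

lemma (in domain) quot_prime_power_val:
  fixes m :: nat
  assumes "p \<in> carrier R" "ring_prime p"
  defines "Q \<equiv> R Quot PIdl (p [^] m)"
  obtains v where "\<And>x. x \<in> carrier Q \<Longrightarrow> x = \<zero>\<^bsub>Q\<^esub> \<longleftrightarrow> m \<le> v x"
    and "\<And>x y. x \<in> carrier Q \<Longrightarrow> y \<in> carrier Q \<Longrightarrow> x \<otimes>\<^bsub>Q\<^esub> y = \<zero>\<^bsub>Q\<^esub> \<longleftrightarrow> m \<le> v x + v y"
proof
  let ?g = "p [^] m"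
  have g: "?g \<in> carrier R" using assms by simp
  define rep where "rep x = (SOME a. a \<in> carrier R \<and> x = PIdl ?g +> a)" for x
  have rep: "rep x \<in> carrier R" "x = PIdl ?g +> rep x" if "x \<in> carrier Q" for x
  proof -
    have "\<exists>a. a \<in> carrier R \<and> x = PIdl ?g +> a"
      using that unfolding Q_def carrier_FactRing by blast
    then have "rep x \<in> carrier R \<and> x = PIdl ?g +> rep x"
      unfolding rep_def by (rule someI_ex)
    then show "rep x \<in> carrier R" "x = PIdl ?g +> rep x"
      by blast+
  qed
  define v where "v x = truncated_val R p m (rep x)" for x
  show "x = \<zero>\<^bsub>Q\<^esub> \<longleftrightarrow> m \<le> v x" if "x \<in> carrier Q" for x
  proof -
    have "x = \<zero>\<^bsub>Q\<^esub> \<longleftrightarrow> ?g divides rep x"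
      using coset_PIdl_eq_zero_iff[OF g rep(1)[OF that]] rep(2)[OF that] by (simp add: Q_def)
    \<comment> \<open>Because of the cap, \<open>m \<le> v x\<close> means that the value is exactly
      \<open>m\<close>.\<close>
    also have "\<dots> \<longleftrightarrow> m \<le> v x"
      using truncated_val[OF rep(1)[OF that], where p = p and m = m] by (auto simp: v_def dest: le_antisym)
    finally show ?thesis .
  qed
  show "x \<otimes>\<^bsub>Q\<^esub> y = \<zero>\<^bsub>Q\<^esub> \<longleftrightarrow> m \<le> v x + v y" if "x \<in> carrier Q" "y \<in> carrier Q" for x y
  proof -
    have "x \<otimes>\<^bsub>Q\<^esub> y = PIdl ?g +> (rep x \<otimes> rep y)"
      using coset_PIdl_mult[OF g rep(1)[OF that(1)] rep(1)[OF that(2)]]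
        rep(2)[OF that(1)] rep(2)[OF that(2)] by (simp add: Q_def)
    then show ?thesis
      using coset_PIdl_eq_zero_iff[OF g] pow_divides_mult_iff[OF assms(1,2)] rep(1) that
      by (simp add: Q_def v_def)
  qed
qed

text \<open>The classes \<open>x\<close> of \<open>p\<close> and \<open>y\<close> of \<open>p^2\<close> are separated by a class \<open>z\<close> of the form
  \<open>p^(m-2) e\<close> with \<open>e\<close> equal to \<open>1\<close> or \<open>1 + p\<close>. Two candidates are needed since \<open>z\<close> must differ
  from \<open>y\<close>, which could fail when \<open>m = 4\<close>.\<close>

lemma (in domain) quot_prime_power_separation:
  fixes m :: nat
  assumes p: "p \<in> carrier R" "ring_prime p" and m: "4 \<le> m"
  defines "Q \<equiv> R Quot PIdl (p [^] m)"
  obtains x y z x' where "x \<in> carrier Q" "y \<in> carrier Q" "z \<in> carrier Q" "x' \<in> carrier Q"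
    and "x \<otimes>\<^bsub>Q\<^esub> y \<noteq> \<zero>\<^bsub>Q\<^esub>" "x \<otimes>\<^bsub>Q\<^esub> z \<noteq> \<zero>\<^bsub>Q\<^esub>" "y \<otimes>\<^bsub>Q\<^esub> z = \<zero>\<^bsub>Q\<^esub>" "y \<noteq> z"
    and "x \<otimes>\<^bsub>Q\<^esub> x' = \<zero>\<^bsub>Q\<^esub>" "x' \<noteq> \<zero>\<^bsub>Q\<^esub>"
proof -
  let ?g = "p [^] m"
  have g: "?g \<in> carrier R" using p by simp
  note zero = coset_PIdl_eq_zero_iff[OF g, folded Q_def]
  note mult = coset_PIdl_mult[OF g, folded Q_def]
  have carr: "PIdl ?g +> a \<in> carrier Q" if "a \<in> carrier R" for a
    using that unfolding Q_def carrier_FactRing by blast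
  have p1: "\<not> p divides \<one>"
    using ring_primeE(3)[OF p] p divides_one by (simp add: prime_def)
  have p2: "\<not> p divides (\<one> \<oplus> p)"
  proof
    assume "p divides (\<one> \<oplus> p)"
    then obtain c where c: "c \<in> carrier R" "\<one> \<oplus> p = p \<otimes> c" by blast
    then have "\<one> = p \<otimes> (c \<ominus> \<one>)"
      using p by (simp add: a_minus_def r_distr r_minus) (metis add.inv_solve_right one_closed c(2) m_closed)
    then show False using p1 c by (metis dividesI minus_closed one_closed)
  qed
  have pow: "\<not> ?g divides p [^] k" if "k < m" for k
    using not_pow_divides[OF p one_closed p1 that] p by simp
  define z where "z e = PIdl ?g +> (p [^] (m - 2) \<otimes> e)" for e
  define x where "x = PIdl ?g +> p"
  define y where "y = PIdl ?g +> (p [^] (2::nat))"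
  \<comment> \<open>A nonzero class annihilated by that of \<open>p\<close>, certifying that
    \<open>x\<close> is a zero divisor.\<close>
  define x' where "x' = PIdl ?g +> (p [^] (m - 1))"
  have z1: "x \<otimes>\<^bsub>Q\<^esub> z e \<noteq> \<zero>\<^bsub>Q\<^esub>" if "e \<in> carrier R" "\<not> p divides e" for e
  proof -
    have "p \<otimes> (p [^] (m - 2) \<otimes> e) = p [^] (1 + (m - 2)) \<otimes> e"
      using p that by (simp add: m_ac)
    moreover have "\<not> ?g divides p [^] (1 + (m - 2)) \<otimes> e"
      using m that by (intro not_pow_divides[OF p]) auto
    ultimately show ?thesis
      using zero p that unfolding x_def z_def by (simp add: mult)
  qed
  have z2: "y \<otimes>\<^bsub>Q\<^esub> z e = \<zero>\<^bsub>Q\<^esub>" if "e \<in> carrier R" for e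
  proof -
    have "p [^] (2::nat) \<otimes> (p [^] (m - 2) \<otimes> e) = p [^] (2 + (m - 2)) \<otimes> e"
      using p that by (simp only: nat_pow_mult[symmetric] m_assoc nat_pow_closed)
    also have "2 + (m - 2) = m"
      using m by simp
    finally have "?g divides p [^] (2::nat) \<otimes> (p [^] (m - 2) \<otimes> e)"
      using that by auto
    then show ?thesis
      using zero p that unfolding y_def z_def by (simp add: mult)
  qed
  \<comment> \<open>The two candidates differ by the class of \<open>p [^] (m - 1)\<close>, which is
    nonzero; hence at least one of them is not \<open>y\<close>.\<close>
  have "z \<one> \<noteq> z (\<one> \<oplus> p)"
  proof -
    have "p [^] (m - 2) \<otimes> (\<one> \<oplus> p) \<ominus> p [^] (m - 2) \<otimes> \<one> = p [^] (m - 2) \<otimes> p"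
      using p by (simp add: r_distr a_minus_def a_ac r_neg2)
    also have "\<dots> = p [^] Suc (m - 2)" by simp
    finally have eq: "p [^] (m - 2) \<otimes> (\<one> \<oplus> p) \<ominus> p [^] (m - 2) \<otimes> \<one> = p [^] Suc (m - 2)" .
    have "\<not> ?g divides (p [^] (m - 2) \<otimes> (\<one> \<oplus> p) \<ominus> p [^] (m - 2) \<otimes> \<one>)"
      unfolding eq using m by (intro pow) simp
    then show ?thesis
      unfolding z_def using coset_PIdl_eq_iff[OF g] p by (metis add.m_closed m_closed nat_pow_closed one_closed)
  qed
  then obtain e where e: "e \<in> carrier R" "\<not> p divides e" "y \<noteq> z e"
    using p p1 p2 by (metis add.m_closed one_closed)
  \<comment> \<open>The bound \<open>4 \<le> m\<close> enters here: \<open>p [^] 3\<close> is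
    nonzero in the quotient.\<close>
  have "p \<otimes> p [^] (2::nat) = p [^] (3::nat)"
    using p by (simp add: numeral_eq_Suc m_ac)
  then have "x \<otimes>\<^bsub>Q\<^esub> y \<noteq> \<zero>\<^bsub>Q\<^esub>"
    using zero p pow[of 3] m unfolding x_def y_def by (simp add: mult)
  moreover have "x \<otimes>\<^bsub>Q\<^esub> x' = \<zero>\<^bsub>Q\<^esub>"
  proof -
    have "p \<otimes> p [^] (m - 1) = p [^] Suc (m - 1)"
      using p by (simp add: m_comm)
    then have "p \<otimes> p [^] (m - 1) = ?g"
      using m by simp
    then show ?thesis
      using zero p unfolding x_def x'_def by (simp add: mult)
  qed
  moreover have "x' \<noteq> \<zero>\<^bsub>Q\<^esub>"
    using zero p pow[of "m - 1"] m unfolding x'_def by simp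
  moreover have "x \<in> carrier Q" "y \<in> carrier Q" "z e \<in> carrier Q" "x' \<in> carrier Q"
    unfolding x_def y_def z_def x'_def using p e by (auto intro: carr)
  ultimately show ?thesis
    using that[of x y "z e" x'] z1[OF e(1,2)] z2[OF e(1)] e(3) by simp
qed

subsection \<open>The zero divisor graph\<close>

context cring
begin

lemma edge_zero_divisor_graph_iff:
  assumes "x \<in> verts (zero_divisor_graph R)" "y \<in> verts (zero_divisor_graph R)"
  shows "{x, y} \<in> edges (zero_divisor_graph R) \<longleftrightarrow> x \<noteq> y \<and> x \<otimes> y = \<zero>"
proof -
  have "x \<in> carrier R" "y \<in> carrier R"
    using assms by (auto simp: zero_divisor_graph_def zero_divisors_def)
  then show ?thesis
    using assms m_comm[of x y] by (auto simp: zero_divisor_graph_def doubleton_eq_iff)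
qed

lemma neighbours_zero_divisor_graph:
  assumes "x \<in> verts (zero_divisor_graph R)"
  shows "neighbours (zero_divisor_graph R) x =
    {y \<in> verts (zero_divisor_graph R). x \<noteq> y \<and> x \<otimes> y = \<zero>}"
  using edge_zero_divisor_graph_iff[OF assms] by (auto simp: neighbours_def)

lemma threshold_zero_divisor_graph:
  fixes v :: "'a \<Rightarrow> nat"
  assumes fin: "finite (carrier R)"
    and v: "\<And>x y. x \<in> carrier R \<Longrightarrow> y \<in> carrier R \<Longrightarrow> x \<otimes> y = \<zero> \<longleftrightarrow> m \<le> v x + v y"
  shows "threshold_graph (zero_divisor_graph R)"
proof -
  let ?G = "zero_divisor_graph R"
  have sub: "verts ?G \<subseteq> carrier R"
    by (auto simp: zero_divisor_graph_def zero_divisors_def)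
  have "{x, y} \<in> edges ?G \<longleftrightarrow> real m \<le> real (v x) + real (v y)"
    if "x \<in> verts ?G" "y \<in> verts ?G" "x \<noteq> y" for x y
    using edge_zero_divisor_graph_iff[OF that(1,2)] v[of x y] that sub by (auto simp: subset_iff)
  then show ?thesis
    unfolding threshold_graph_iff using simple_zero_divisor_graph finite_subset[OF sub fin]
    by (intro conjI exI[of _ "\<lambda>x. real (v x)"] exI[of _ "real m"]) simp_all
qed

lemma complete_zero_divisor_graph:
  fixes v :: "'a \<Rightarrow> nat"
  assumes v0: "\<And>x. x \<in> carrier R \<Longrightarrow> x = \<zero> \<longleftrightarrow> m \<le> v x"
    and v: "\<And>x y. x \<in> carrier R \<Longrightarrow> y \<in> carrier R \<Longrightarrow> x \<otimes> y = \<zero> \<longleftrightarrow> m \<le> v x + v y"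
    and m: "m \<le> 3"
    and xy: "x \<in> verts (zero_divisor_graph R)" "y \<in> verts (zero_divisor_graph R)"
    and ne: "neighbours (zero_divisor_graph R) x \<noteq> neighbours (zero_divisor_graph R) y"
  shows "{x, y} \<in> edges (zero_divisor_graph R)"
proof (rule ccontr)
  let ?V = "verts (zero_divisor_graph R)"
  \<comment> \<open>A nonzero annihilator \<open>s\<close> has \<open>v s < m\<close>, while
    \<open>z \<otimes> s = \<zero>\<close> requires a sum of at least \<open>m\<close>.\<close>
  have V: "z \<in> carrier R \<and> 1 \<le> v z" if z: "z \<in> ?V" for z
  proof -
    obtain s where zs: "z \<in> carrier R" "s \<in> carrier R" "s \<noteq> \<zero>" "z \<otimes> s = \<zero>"
      using z unfolding zero_divisor_graph_def zero_divisors_def ugraph.simps by blast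
    then show ?thesis
      using v0[of s] v[of z s] by auto
  qed
  assume "{x, y} \<notin> edges (zero_divisor_graph R)"
  moreover have "x \<noteq> y" using ne by blast
  ultimately have "\<not> m \<le> v x + v y"
    using edge_zero_divisor_graph_iff[OF xy] v[of x y] V xy by blast
  then have one: "v x = 1" "v y = 1" "m = 3"
    using V[OF xy(1)] V[OF xy(2)] m by linarith+
  \<comment> \<open>The requirement that a neighbour differ from \<open>z\<close> is automatic, as
    \<open>z\<close> itself has valuation 1.\<close>
  have "neighbours (zero_divisor_graph R) z = {w \<in> ?V. 2 \<le> v w}" if "z \<in> ?V" "v z = 1" for z
    unfolding neighbours_zero_divisor_graph[OF that(1)]
    using v[of z] V that one(3) by auto
  then show False
    using ne xy one by simp
qed

end

theorem lemma78:
  fixes R :: "('a, 'b) ring_scheme" (structure)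
    and I :: "'a set" and g u p :: 'a and m :: nat
  assumes "principal_domain R"
    and "g \<in> carrier R"
    and "I = PIdl g"
    and "I \<subset> carrier R"
    and "\<not> primeideal I R"
    and "finite (carrier (R Quot I))"
    and "u \<in> Units R"
    and "p \<in> carrier R"
    and "ring_prime p"
    and "m \<ge> 1"
    and "g = u \<otimes> p [^] m"
  shows "threshold_dim (reduced_zero_divisor_graph (R Quot I))
           = boxicity (reduced_zero_divisor_graph (R Quot I)) \<and>
         boxicity (reduced_zero_divisor_graph (R Quot I)) = (if m \<le> 3 then 0 else 1)"
proof -
  interpret principal_domain R by fact
  note p = \<open>p \<in> carrier R\<close> \<open>ring_prime p\<close>
  have pm: "p [^] m \<in> carrier R" using p by simp
  \<comment> \<open>The unit is absorbed: associated elements generate the same ideal.\<close>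
  have "g = p [^] m \<otimes> u"
    using assms(7,11) pm m_comm by (simp add: Units_closed)
  then have "g \<sim> p [^] m"
    using assms(7) pm by (intro associatedI2')
  then have I: "I = PIdl (p [^] m)"
    using associated_iff_same_ideal assms(2,3) pm by blast
  let ?Q = "R Quot I"
  let ?G = "zero_divisor_graph ?Q"
  interpret Q: cring ?Q
    unfolding I by (rule ideal.quotient_is_cring[OF cgenideal_ideal[OF pm] is_cring])
  obtain v where v: "\<And>x. x \<in> carrier ?Q \<Longrightarrow> x = \<zero>\<^bsub>?Q\<^esub> \<longleftrightarrow> m \<le> v x"
      "\<And>x y. x \<in> carrier ?Q \<Longrightarrow> y \<in> carrier ?Q \<Longrightarrow> x \<otimes>\<^bsub>?Q\<^esub> y = \<zero>\<^bsub>?Q\<^esub> \<longleftrightarrow> m \<le> v x + v y"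
    using quot_prime_power_val[OF p, of m] unfolding I by blast
  have complete: "(\<forall>x\<in>verts ?G. \<forall>y\<in>verts ?G. neighbours ?G x \<noteq> neighbours ?G y \<longrightarrow> {x, y} \<in> edges ?G)
      \<longleftrightarrow> m \<le> 3" (is "?C \<longleftrightarrow> _")
  proof
    show ?C if "m \<le> 3"
      using Q.complete_zero_divisor_graph[OF v that] by blast
  next
    assume C: ?C
    show "m \<le> 3"
    proof (rule ccontr)
      assume "\<not> m \<le> 3"
      then have m4: "4 \<le> m" by simp
      obtain x y z x' where carr: "x \<in> carrier ?Q" "y \<in> carrier ?Q" "z \<in> carrier ?Q" "x' \<in> carrier ?Q"
        and xy: "x \<otimes>\<^bsub>?Q\<^esub> y \<noteq> \<zero>\<^bsub>?Q\<^esub>" and xz: "x \<otimes>\<^bsub>?Q\<^esub> z \<noteq> \<zero>\<^bsub>?Q\<^esub>"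
        and yz: "y \<otimes>\<^bsub>?Q\<^esub> z = \<zero>\<^bsub>?Q\<^esub>" "y \<noteq> z"
        and x': "x \<otimes>\<^bsub>?Q\<^esub> x' = \<zero>\<^bsub>?Q\<^esub>" "x' \<noteq> \<zero>\<^bsub>?Q\<^esub>"
        by (rule quot_prime_power_separation[OF p m4, folded I]) (rule that)
      have "x \<noteq> \<zero>\<^bsub>?Q\<^esub>" "y \<noteq> \<zero>\<^bsub>?Q\<^esub>" "z \<noteq> \<zero>\<^bsub>?Q\<^esub>"
        using xy xz carr by auto
      moreover have "z \<otimes>\<^bsub>?Q\<^esub> y = \<zero>\<^bsub>?Q\<^esub>"
        using yz(1) carr Q.m_comm by simp
      \<comment> \<open>Nonzero annihilators of \<open>x\<close>, \<open>y\<close> and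
        \<open>z\<close> are \<open>x'\<close>, \<open>z\<close> and \<open>y\<close>,
        respectively.\<close>
      ultimately have V: "x \<in> verts ?G" "y \<in> verts ?G" "z \<in> verts ?G"
        using yz(1) x' carr by (auto simp: zero_divisor_graph_def zero_divisors_def)
      \<comment> \<open>The vertex \<open>z\<close> is a neighbour of \<open>y\<close> but not of
        \<open>x\<close>.\<close>
      have "neighbours ?G x \<noteq> neighbours ?G y"
        using Q.neighbours_zero_divisor_graph[OF V(1)] Q.neighbours_zero_divisor_graph[OF V(2)]
          V(3) xz yz by blast
      then show False
        using C V xy Q.edge_zero_divisor_graph_iff[OF V(1,2)] by blast
    qed
  qed
  have "threshold_graph (reduced_graph ?G)"
    using Q.threshold_zero_divisor_graph[OF assms(6) v(2)] by (rule threshold_graph_reduced_graph)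
  note dims = threshold_graph_dimensions[OF this]
  show ?thesis
    unfolding dims complete_reduced_graph_iff[OF simple_zero_divisor_graph] complete by simp
qed

end
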